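(* Let $X\subset\mathbb{R}^n$ be a robust heteroclinic cycle or robust heteroclinic network with equilibria $\xi_j$. Assume that $X$ is compact. If there exists an equilibrium $\xi_j\in X$ such that $W^u(\xi_j)\not\subset X$, then $X$ is not asymptotically stable.
   Context: Let $\dot x=f(x)$ be a smooth vector field on $\mathbb{R}^n$, equivariant under a compact Lie group $\Gamma$ ($f(\gamma x)=\gamma f(x)$), with flow $\Phi_t$. For an equilibrium $\xi$, $W^u(\xi)$ and $W^s(\xi)$ are its unstable and stable manifolds. A heteroclinic cycle consists of equilibria $\xi_1,\dots,\xi_m$ and trajectories (connections) $\kappa_{j,j+1}=[\xi_j\to\xi_{j+1}]\subset W^u(\xi_j)\cap W^s(\xi_{j+1})\neq\varnothing$, $j=1,\dots,m$, where $\xi_{m+1}=\gamma\xi_1$ for some $\gamma\in\Gamma$. Equilibria (and connections) in the same $\Gamma$-orbit are identified. A heteroclinic network is a connected set that is the union of two or more heteroclinic cycles. A cycle or network is robust when each connection lies in a fixed-point space $\mathrm{Fix}(\Sigma)=\{x:\sigma x=x\ \forall\sigma\in\Sigma\}$ of a subgroup $\Sigma\subset\Gamma$, and within this space the connection goes from a saddle to a sink. For a compact invariant set $X$ and $\delta>0$, the $\delta$-basin of attraction is $\mathcal{B}_\delta(X)=\{x\in\mathbb{R}^n: d(\Phi_t(x),X)<\delta \text{ for all } t>0 \text{ and } \lim_{t\to+\infty}d(\Phi_t(x),X)=0\}$, and $N_\varepsilon(X)$ is the $\varepsilon$-neighbourhood of $X$. $X$ is asymptotically stable if for any $\delta>0$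 there is $\varepsilon>0$ with $N_\varepsilon(X)\subset\mathcal{B}_\delta(X)$. *)

theory Defs
  imports "HOL-Analysis.Analysis"
begin

text \<open>\<open>C_k k f\<close>: all iterated directional derivatives of \<open>f\<close> of order below \<open>k\<close> exist and are
  differentiable, and those of order \<open>k\<close> are continuous.\<close>

primrec C_k :: "nat \<Rightarrow> ('a::real_normed_vector \<Rightarrow> 'b::real_normed_vector) \<Rightarrow> bool" where
  "C_k 0 f \<longleftrightarrow> continuous_on UNIV f"
| "C_k (Suc k) f \<longleftrightarrow> (\<forall>x. f differentiable (at x)) \<and>
     (\<forall>v. C_k k (\<lambda>x. frechet_derivative f (at x) v))"

definition smooth :: "('a::real_normed_vector \<Rightarrow> 'b::real_normed_vector) \<Rightarrow> bool" where
  "smooth f \<longleftrightarrow> (\<forall>k. C_k k f)"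

definition solution_on :: "('a::real_normed_vector \<Rightarrow> 'a) \<Rightarrow> real set \<Rightarrow> (real \<Rightarrow> 'a) \<Rightarrow> bool" where
  "solution_on f I u \<longleftrightarrow> (\<forall>t\<in>I. (u has_vector_derivative f (u t)) (at t within I))"

text \<open>Completeness of the vector field is not assumed. \<open>flow_defined f t x\<close> says that \<open>t\<close> lies in
  the maximal interval of existence of the solution through \<open>x\<close>; the value \<open>flow f t x\<close> is
  meaningful only in that case, and is then unique when \<open>f\<close> is smooth.\<close>

definition flow_defined :: "('a::real_normed_vector \<Rightarrow> 'a) \<Rightarrow> real \<Rightarrow> 'a \<Rightarrow> bool" where
  "flow_defined f t x \<longleftrightarrow> (\<exists>u. u 0 = x \<and> solution_on f (closed_segment 0 t) u)"

definition flow :: "('a::real_normed_vector \<Rightarrow> 'a) \<Rightarrow> real \<Rightarrow> 'a \<Rightarrow> 'a" where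
  "flow f t x = (THE y. \<exists>u. u 0 = x \<and> solution_on f (closed_segment 0 t) u \<and> u t = y)"

definition trajectory :: "('a::real_normed_vector \<Rightarrow> 'a) \<Rightarrow> 'a \<Rightarrow> 'a set" where
  "trajectory f x = {flow f t x |t. flow_defined f t x}"

definition equilibrium :: "('a::real_normed_vector \<Rightarrow> 'a) \<Rightarrow> 'a \<Rightarrow> bool" where
  "equilibrium f \<xi> \<longleftrightarrow> f \<xi> = 0"

definition unstable_manifold :: "('a::real_normed_vector \<Rightarrow> 'a) \<Rightarrow> 'a \<Rightarrow> 'a set" where
  "unstable_manifold f \<xi> =
     {x. (\<forall>t\<le>0. flow_defined f t x) \<and> ((\<lambda>t. flow f t x) \<longlongrightarrow> \<xi>) at_bot}"

definition stable_manifold :: "('a::real_normed_vector \<Rightarrow> 'a) \<Rightarrow> 'a \<Rightarrow> 'a set" where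
  "stable_manifold f \<xi> =
     {x. (\<forall>t\<ge>0. flow_defined f t x) \<and> ((\<lambda>t. flow f t x) \<longlongrightarrow> \<xi>) at_top}"

definition matrix_group :: "(real^'n^'n) set \<Rightarrow> bool" where
  "matrix_group G \<longleftrightarrow> mat 1 \<in> G \<and> (\<forall>A\<in>G. \<forall>B\<in>G. A ** B \<in> G) \<and>
     (\<forall>A\<in>G. invertible A \<and> matrix_inv A \<in> G)"

text \<open>A compact Lie group acting linearly on \<open>\<real>\<^sup>n\<close> enters only through its image in the general
  linear group, which is a compact matrix group; conversely every compact matrix group is a
  compact Lie group.\<close>

definition compact_matrix_group :: "(real^'n^'n) set \<Rightarrow> bool" where
  "compact_matrix_group G \<longleftrightarrow> matrix_group G \<and> compact G"

definition equivariant :: "(real^'n^'n) set \<Rightarrow> (real^'n \<Rightarrow> real^'n) \<Rightarrow> bool" where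
  "equivariant G f \<longleftrightarrow> (\<forall>\<gamma>\<in>G. \<forall>x. f (\<gamma> *v x) = \<gamma> *v f x)"

definition Fix :: "(real^'n^'n) set \<Rightarrow> (real^'n) set" where
  "Fix S = {x. \<forall>\<sigma>\<in>S. \<sigma> *v x = x}"

text \<open>For a subspace \<open>V\<close> invariant under the linear map \<open>L\<close>: the complex number \<open>\<mu>\<close> is an eigenvalue
  of the complexification of the restriction of \<open>L\<close> to \<open>V\<close>, with eigenvector \<open>u + i v\<close>. The two
  equations are the real and imaginary parts of \<open>L (u + i v) = \<mu> (u + i v)\<close>.\<close>

definition eigenvalue_on :: "('a::real_vector \<Rightarrow> 'a) \<Rightarrow> 'a set \<Rightarrow> complex \<Rightarrow> bool" where
  "eigenvalue_on L V \<mu> \<longleftrightarrow> (\<exists>u\<in>V. \<exists>v\<in>V. (u \<noteq> 0 \<or> v \<noteq> 0) \<and>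
     L u = Re \<mu> *\<^sub>R u - Im \<mu> *\<^sub>R v \<and> L v = Im \<mu> *\<^sub>R u + Re \<mu> *\<^sub>R v)"

text \<open>A saddle is not required to be hyperbolic: eigenvalues on the imaginary axis (for instance
  those along a continuous group orbit of equilibria) are allowed.\<close>

definition saddle_in :: "('a::real_normed_vector \<Rightarrow> 'a) \<Rightarrow> 'a set \<Rightarrow> 'a \<Rightarrow> bool" where
  "saddle_in f V \<xi> \<longleftrightarrow> \<xi> \<in> V \<and> equilibrium f \<xi> \<and>
     (\<exists>\<mu>. eigenvalue_on (frechet_derivative f (at \<xi>)) V \<mu> \<and> Re \<mu> > 0) \<and>
     (\<exists>\<mu>. eigenvalue_on (frechet_derivative f (at \<xi>)) V \<mu> \<and> Re \<mu> < 0)"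

definition sink_in :: "('a::real_normed_vector \<Rightarrow> 'a) \<Rightarrow> 'a set \<Rightarrow> 'a \<Rightarrow> bool" where
  "sink_in f V \<xi> \<longleftrightarrow> \<xi> \<in> V \<and> equilibrium f \<xi> \<and>
     (\<forall>\<mu>. eigenvalue_on (frechet_derivative f (at \<xi>)) V \<mu> \<longrightarrow> Re \<mu> < 0)"

text \<open>\<open>\<kappa> j\<close> is the connection from \<open>\<xi> j\<close> to \<open>\<xi> (Suc j)\<close>, for \<open>1 \<le> j \<le> m\<close>.\<close>

definition cycle_data ::
  "(real^'n \<Rightarrow> real^'n) \<Rightarrow> (real^'n^'n) set \<Rightarrow> nat \<Rightarrow> (nat \<Rightarrow> real^'n) \<Rightarrow> (nat \<Rightarrow> (real^'n) set) \<Rightarrow> bool"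
  where
  "cycle_data f G m \<xi> \<kappa> \<longleftrightarrow> m \<ge> 1 \<and>
     (\<forall>j\<in>{1..m}. equilibrium f (\<xi> j)) \<and>
     (\<exists>\<gamma>\<in>G. \<xi> (Suc m) = \<gamma> *v \<xi> 1) \<and>
     (\<forall>j\<in>{1..m}. (\<exists>x. \<kappa> j = trajectory f x) \<and>
        \<kappa> j \<subseteq> unstable_manifold f (\<xi> j) \<inter> stable_manifold f (\<xi> (Suc j)))"

definition robust_data ::
  "(real^'n \<Rightarrow> real^'n) \<Rightarrow> (real^'n^'n) set \<Rightarrow> nat \<Rightarrow> (nat \<Rightarrow> real^'n) \<Rightarrow> (nat \<Rightarrow> (real^'n) set) \<Rightarrow> bool"
  where
  "robust_data f G m \<xi> \<kappa> \<longleftrightarrow> (\<forall>j\<in>{1..m}. \<exists>S. matrix_group S \<and> S \<subseteq> G \<and> \<kappa> j \<subseteq> Fix S \<and>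
     saddle_in f (Fix S) (\<xi> j) \<and> sink_in f (Fix S) (\<xi> (Suc j)))"

text \<open>Equilibria and connections in the same orbit of \<open>G\<close> are identified, so the data of a cycle
  determine a subset of \<open>\<real>\<^sup>n\<close> only up to the choice of which symmetric copies are included. Any
  nonempty set \<open>A \<subseteq> G\<close> of copies is allowed: \<open>A = {mat 1}\<close> gives just the listed equilibria and
  connections, \<open>A = G\<close> their full group orbit.\<close>

definition cycle_set ::
  "(real^'n^'n) set \<Rightarrow> nat \<Rightarrow> (nat \<Rightarrow> real^'n) \<Rightarrow> (nat \<Rightarrow> (real^'n) set) \<Rightarrow> (real^'n) set" where
  "cycle_set A m \<xi> \<kappa> = (\<Union>\<gamma>\<in>A. (\<lambda>x. \<gamma> *v x) ` (\<Union>j\<in>{1..m}. insert (\<xi> j) (\<kappa> j)))"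

definition robust_heteroclinic_cycle ::
  "(real^'n \<Rightarrow> real^'n) \<Rightarrow> (real^'n^'n) set \<Rightarrow> (real^'n) set \<Rightarrow> bool" where
  "robust_heteroclinic_cycle f G X \<longleftrightarrow> (\<exists>m \<xi> \<kappa> A. cycle_data f G m \<xi> \<kappa> \<and> robust_data f G m \<xi> \<kappa> \<and>
     A \<noteq> {} \<and> A \<subseteq> G \<and> X = cycle_set A m \<xi> \<kappa>)"

text \<open>The family \<open>\<C>\<close> of cycles may be infinite, as happens when the intersection of an unstable
  and a stable manifold contains a continuum of connections.\<close>

definition robust_heteroclinic_network ::
  "(real^'n \<Rightarrow> real^'n) \<Rightarrow> (real^'n^'n) set \<Rightarrow> (real^'n) set \<Rightarrow> bool" where
  "robust_heteroclinic_network f G X \<longleftrightarrow> connected X \<and>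
     (\<exists>\<C>. (\<forall>C\<in>\<C>. robust_heteroclinic_cycle f G C) \<and>
        (\<exists>C1\<in>\<C>. \<exists>C2\<in>\<C>. C1 \<noteq> C2) \<and> X = \<Union>\<C>)"

definition basin :: "('a::real_normed_vector \<Rightarrow> 'a) \<Rightarrow> real \<Rightarrow> 'a set \<Rightarrow> 'a set" where
  "basin f \<delta> X = {x. (\<forall>t>0. flow_defined f t x \<and> infdist (flow f t x) X < \<delta>) \<and>
     ((\<lambda>t. infdist (flow f t x) X) \<longlongrightarrow> 0) at_top}"

definition nbhd :: "real \<Rightarrow> 'a::metric_space set \<Rightarrow> 'a set" where
  "nbhd \<epsilon> X = {x. infdist x X < \<epsilon>}"

definition asymptotically_stable :: "('a::real_normed_vector \<Rightarrow> 'a) \<Rightarrow> 'a set \<Rightarrow> bool" where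
  "asymptotically_stable f X \<longleftrightarrow> (\<forall>\<delta>>0. \<exists>\<epsilon>>0. nbhd \<epsilon> X \<subseteq> basin f \<delta> X)"

end

theory Submission
  imports Defs
begin

text \<open>A point of the unstable manifold outside \<open>X\<close> is at positive distance from \<open>X\<close>, yet its backward
  orbit comes arbitrarily close to \<open>X\<close>. Flowing forward again from such a nearby point leads back to
  the original point, which contradicts stability. That the forward flow undoes the backward flow is
  uniqueness of solutions, by a Gronwall estimate on the squared distance of two solutions.\<close>

text \<open>\<open>C_k\<close> controls the directional derivatives one direction at a time, so a
  bound in operator norm has to be assembled: each of the finitely many basis directions contributes
  its maximum over the compact set, and expanding a vector in \<open>Basis\<close> shows that the
  sum of these maxima suffices.\<close>

lemma C1_bounded_derivative:
  fixes f :: "'a::euclidean_space \<Rightarrow> 'b::real_normed_vector"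
  assumes "C_k 1 f" "compact S"
  obtains B where "B \<ge> 0" "\<And>x. x \<in> S \<Longrightarrow> onorm (frechet_derivative f (at x)) \<le> B"
proof -
  have cont: "continuous_on S (\<lambda>x. frechet_derivative f (at x) i)" for i
    using assms(1) continuous_on_subset by fastforce
  have "\<exists>c\<ge>0. \<forall>x\<in>S. norm (frechet_derivative f (at x) i) \<le> c" for i
  proof -
    have "bounded ((\<lambda>x. frechet_derivative f (at x) i) ` S)"
      by (intro compact_imp_bounded compact_continuous_image cont assms)
    then show ?thesis
      unfolding bounded_pos by (auto intro: less_imp_le)
  qed
  then obtain c where c: "\<And>i. c i \<ge> 0"
      "\<And>i x. x \<in> S \<Longrightarrow> norm (frechet_derivative f (at x) i) \<le> c i"
    by metis
  show ?thesis
  proof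
    show "0 \<le> sum c Basis"
      by (intro sum_nonneg c)
    fix x assume x: "x \<in> S"
    let ?D = "frechet_derivative f (at x)"
    have "linear ?D"
      using assms(1) by (auto intro: linear_frechet_derivative)
    have "norm (?D v) \<le> sum c Basis * norm v" for v
    proof -
      have "?D v = ?D (\<Sum>i\<in>Basis. (v \<bullet> i) *\<^sub>R i)"
        by (simp add: euclidean_representation)
      also have "\<dots> = (\<Sum>i\<in>Basis. (v \<bullet> i) *\<^sub>R ?D i)"
        using \<open>linear ?D\<close> by (simp add: linear_sum linear_scale)
      also have "norm \<dots> \<le> (\<Sum>i\<in>Basis. norm v * c i)"
        by (rule sum_norm_le) (auto intro!: mult_mono Basis_le_norm c x)
      finally show ?thesis
        by (simp add: sum_distrib_left mult.commute)
    qed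
    then show "onorm ?D \<le> sum c Basis"
      by (rule onorm_le)
  qed
qed

text \<open>A closed ball is compact, which bounds the derivative, and convex, which lets the mean
  value inequality turn that bound into a Lipschitz constant.\<close>

lemma C1_lipschitz_on_cball:
  fixes f :: "'a::euclidean_space \<Rightarrow> 'b::real_normed_vector"
  assumes "C_k 1 f"
  obtains L where "L-lipschitz_on (cball a r) f"
proof -
  obtain B where B: "B \<ge> 0"
      "\<And>x. x \<in> cball a r \<Longrightarrow> onorm (frechet_derivative f (at x)) \<le> B"
    using C1_bounded_derivative[OF assms compact_cball] by blast
  have der: "(f has_derivative frechet_derivative f (at x)) (at x within cball a r)" for x
    using assms by (auto intro: has_derivative_at_withinI simp flip: frechet_derivative_works)
  have "norm (f x - f y) \<le> B * norm (x - y)" if "x \<in> cball a r" "y \<in> cball a r" for x y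
    by (rule differentiable_bound[OF convex_cball der B(2) that])
  then have "B-lipschitz_on (cball a r) f"
    using B(1) by (auto intro: lipschitz_onI simp: dist_norm)
  then show thesis by (rule that)
qed

text \<open>The integrating factor \<open>exp (- K * s)\<close> turns the differential inequality
  into a nonpositive derivative, so by the mean value theorem the product cannot rise above its
  initial value 0. No sign is imposed on \<open>K\<close>.\<close>

lemma gronwall_zero:
  fixes g :: "real \<Rightarrow> real"
  assumes der: "\<And>s. s \<in> {0..1} \<Longrightarrow> (g has_real_derivative g' s) (at s within {0..1})"
    and le: "\<And>s. s \<in> {0..1} \<Longrightarrow> g' s \<le> K * g s"
    and "g 0 = 0"
  shows "g 1 \<le> 0"
proof -
  let ?h = "\<lambda>s. exp (- K * s) * g s"
  have "(?h has_derivative (*) (exp (- K * s) * (g' s - K * g s))) (at s within {0..1})"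
    if "s \<in> {0..1}" for s
    unfolding has_field_derivative_def[symmetric]
    by (rule derivative_eq_intros der that refl)+ (simp add: algebra_simps)
  then obtain s where s: "s \<in> {0..1}"
      "?h 1 - ?h 0 = exp (- K * s) * (g' s - K * g s) * (1 - 0)"
    using mvt_very_simple[of 0 1 ?h "\<lambda>s. (*) (exp (- K * s) * (g' s - K * g s))"] by auto
  have "exp (- K * s) * (g' s - K * g s) \<le> 0"
    using le[OF s(1)] by (simp add: mult_nonneg_nonpos)
  then have "exp (- K) * g 1 \<le> 0"
    using s(2) \<open>g 0 = 0\<close> by simp
  then show ?thesis
    by (simp add: mult_le_0_iff)
qed

text \<open>Reparametrising to the unit interval treats forward, backward and zero time alike: the
  sign of \<open>t\<close> survives only as a factor of the vector field.\<close>

lemma solution_on_rescale: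
  assumes "solution_on f (closed_segment 0 t) u" "s \<in> {0..1}"
  shows "((\<lambda>s. u (s * t)) has_vector_derivative t *\<^sub>R f (u (s * t))) (at s within {0..1})"
proof -
  have img: "(\<lambda>s. s * t) ` {0..1} = closed_segment 0 t"
    by (auto simp: closed_segment_def image_iff)
  have "s * t \<in> closed_segment 0 t"
    using img assms(2) by blast
  then have "(u has_vector_derivative f (u (s * t))) (at (s * t) within (\<lambda>s. s * t) ` {0..1})"
    using assms(1) by (simp add: solution_on_def img)
  moreover have "((\<lambda>s. s * t) has_vector_derivative t) (at s within {0..1})"
    by (auto intro!: derivative_eq_intros simp flip: has_real_derivative_iff_has_vector_derivative)
  ultimately show ?thesis
    using vector_diff_chain_within[of "\<lambda>s. s * t"] by (simp add: o_def)
qed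

lemma solution_on_unique:
  fixes f :: "'a::euclidean_space \<Rightarrow> 'a"
  assumes "C_k 1 f"
    and u: "solution_on f (closed_segment 0 t) u"
    and v: "solution_on f (closed_segment 0 t) v"
    and "u 0 = v 0"
  shows "u t = v t"
proof -
  define p q where "p = (\<lambda>s. u (s * t))" and "q = (\<lambda>s. v (s * t))"
  have p: "(p has_vector_derivative t *\<^sub>R f (p s)) (at s within {0..1})"
    and q: "(q has_vector_derivative t *\<^sub>R f (q s)) (at s within {0..1})" if "s \<in> {0..1}" for s
    unfolding p_def q_def using u v that by (auto intro: solution_on_rescale)
  have "continuous_on {0..1} p" "continuous_on {0..1} q"
    unfolding continuous_on_eq_continuous_within
    using p[THEN has_vector_derivative_continuous] q[THEN has_vector_derivative_continuous]
    by blast+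
  \<comment> \<open>The vector field is only locally Lipschitz. Both solution curves are compact, so
    a single ball contains them and one constant \<open>L\<close> serves for both.\<close>
  then have "bounded (p ` {0..1} \<union> q ` {0..1})"
    by (simp add: compact_imp_bounded compact_continuous_image)
  then obtain a r where r: "p ` {0..1} \<union> q ` {0..1} \<subseteq> cball a r"
    unfolding bounded_subset_cball by (elim exE conjE)
  obtain L where L: "L-lipschitz_on (cball a r) f"
    using C1_lipschitz_on_cball[OF assms(1)] by blast
  \<comment> \<open>The squared distance, unlike the distance, is differentiable even where the two
    curves meet.\<close>
  define g where "g s = (p s - q s) \<bullet> (p s - q s)" for s
  define g' where "g' s = 2 * (t * ((p s - q s) \<bullet> (f (p s) - f (q s))))" for s
  have "g 1 \<le> 0"
  proof (rule gronwall_zero)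
    fix s :: real assume s: "s \<in> {0..1}"
    have "((\<lambda>s. p s - q s) has_vector_derivative t *\<^sub>R f (p s) - t *\<^sub>R f (q s)) (at s within {0..1})"
      by (intro has_vector_derivative_diff p q s)
    then have d: "((\<lambda>s. p s - q s) has_derivative (\<lambda>h. h *\<^sub>R (t *\<^sub>R f (p s) - t *\<^sub>R f (q s))))
        (at s within {0..1})"
      by (simp add: has_vector_derivative_def)
    show "(g has_real_derivative g' s) (at s within {0..1})"
      unfolding has_field_derivative_def g_def
      by (rule has_derivative_eq_rhs[OF has_derivative_inner[OF d d]])
        (auto simp: g'_def fun_eq_iff inner_commute algebra_simps)
    have "p s \<in> cball a r" "q s \<in> cball a r"
      using r s by blast+
    then have "norm (f (p s) - f (q s)) \<le> L * norm (p s - q s)"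
      using lipschitz_onD[OF L, of "p s" "q s"] by (simp add: dist_norm)
    then have "norm (p s - q s) * norm (f (p s) - f (q s)) \<le> norm (p s - q s) * (L * norm (p s - q s))"
      by (rule mult_left_mono) simp
    then have "\<bar>(p s - q s) \<bullet> (f (p s) - f (q s))\<bar> \<le> L * g s"
      using Cauchy_Schwarz_ineq2[of "p s - q s" "f (p s) - f (q s)"]
      by (simp add: g_def dot_square_norm power2_eq_square mult_ac)
    \<comment> \<open>Since \<open>t\<close> may be negative, the inner product is bounded in
      absolute value before it is multiplied by the time factor; this is where
      \<open>\<bar>t\<bar>\<close> in the Gronwall constant comes from.\<close>
    then have "\<bar>t\<bar> * \<bar>(p s - q s) \<bullet> (f (p s) - f (q s))\<bar> \<le> \<bar>t\<bar> * (L * g s)"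
      by (rule mult_left_mono) simp
    then show "g' s \<le> (2 * \<bar>t\<bar> * L) * g s"
      unfolding g'_def abs_mult[symmetric] by linarith
  next
    show "g 0 = 0"
      using assms(4) by (simp add: g_def p_def q_def)
  qed
  \<comment> \<open>A squared norm that is at most 0 vanishes, and the rescaled time 1 is the
    original time \<open>t\<close>.\<close>
  then show ?thesis
    by (simp add: g_def p_def q_def dot_square_norm)
qed

text \<open>Uniqueness justifies the definite description in \<open>flow\<close>, so any solution at
  hand computes it.\<close>

lemma flow_eqI:
  fixes f :: "'a::euclidean_space \<Rightarrow> 'a"
  assumes "C_k 1 f" "solution_on f (closed_segment 0 t) u" "u 0 = x"
  shows "flow f t x = u t"
  unfolding flow_def
  by (rule the_equality) (use assms solution_on_unique in \<open>fastforce+\<close>)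

text \<open>If \<open>u\<close> solves the equation from \<open>x\<close>, its time shift by
  \<open>t\<close> starts at \<open>u t\<close> and reaches \<open>u 0 = x\<close> at time
  \<open>- t\<close>. The shifted segment is exactly the one on which \<open>u\<close> is already a
  solution, so no further existence result enters.\<close>

lemma flow_inverse:
  fixes f :: "'a::euclidean_space \<Rightarrow> 'a"
  assumes "C_k 1 f" "flow_defined f t x"
  shows "flow f (- t) (flow f t x) = x"
proof -
  obtain u where u: "u 0 = x" "solution_on f (closed_segment 0 t) u"
    using assms(2) by (auto simp: flow_defined_def)
  have seg: "(\<lambda>s. s + t) ` closed_segment 0 (- t) = closed_segment 0 t"
    using closed_segment_translation[of t 0 "- t"]
    by (simp add: add.commute closed_segment_commute)
  have "solution_on f (closed_segment 0 (- t)) (\<lambda>s. u (s + t))"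
    unfolding solution_on_def
  proof
    fix s assume "s \<in> closed_segment 0 (- t)"
    then have "s + t \<in> closed_segment 0 t"
      using seg by blast
    then have "(u has_vector_derivative f (u (s + t)))
        (at (s + t) within (\<lambda>s. s + t) ` closed_segment 0 (- t))"
      using u(2) by (simp add: solution_on_def seg)
    moreover have "((\<lambda>s. s + t) has_vector_derivative 1) (at s within closed_segment 0 (- t))"
      by (auto intro!: derivative_eq_intros simp flip: has_real_derivative_iff_has_vector_derivative)
    ultimately show "((\<lambda>s. u (s + t)) has_vector_derivative f (u (s + t)))
        (at s within closed_segment 0 (- t))"
      using vector_diff_chain_within[of "\<lambda>s. s + t"] by (fastforce simp: o_def)
  qed
  then have "flow f (- t) (u t) = u (- t + t)"
    by (intro flow_eqI[where u = "\<lambda>s. u (s + t)"] assms(1)) auto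
  then show ?thesis
    using u flow_eqI[OF assms(1) u(2) u(1)] by simp
qed

lemma asymptotically_stable_imp_unstable_manifold_subset:
  fixes f :: "'a::euclidean_space \<Rightarrow> 'a"
  assumes "C_k 1 f" "closed X" "\<xi> \<in> X" "asymptotically_stable f X"
  shows "unstable_manifold f \<xi> \<subseteq> X"
proof
  fix x assume x: "x \<in> unstable_manifold f \<xi>"
  show "x \<in> X"
  proof (rule ccontr)
    assume "x \<notin> X"
    then have "infdist x X > 0"
      using assms(2,3) infdist_pos_not_in_closed by blast
    \<comment> \<open>Taking the distance of \<open>x\<close> itself as the stability radius makes
      the return to \<open>x\<close> a violation of the strict bound in
      \<open>basin\<close>.\<close>
    then obtain \<epsilon> where \<epsilon>: "\<epsilon> > 0" "nbhd \<epsilon> X \<subseteq> basin f (infdist x X) X"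
      using assms(4) by (auto simp: asymptotically_stable_def)
    have "((\<lambda>t. flow f t x) \<longlongrightarrow> \<xi>) at_bot"
      using x by (simp add: unstable_manifold_def)
    then have "\<forall>\<^sub>F t in at_bot. dist (flow f t x) \<xi> < \<epsilon>"
      using \<epsilon>(1) by (rule tendstoD)
    \<comment> \<open>Strict negativity of \<open>t\<close> matters: \<open>basin\<close> constrains
      only positive times, and the return takes time \<open>- t\<close>.\<close>
    then have "\<forall>\<^sub>F t in at_bot. dist (flow f t x) \<xi> < \<epsilon> \<and> t < 0"
      by (intro eventually_conj eventually_gt_at_bot)
    then obtain t where t: "dist (flow f t x) \<xi> < \<epsilon>" "t < 0"
      using eventually_happens'[OF trivial_limit_at_bot_linorder] by blast
    have "flow f t x \<in> nbhd \<epsilon> X"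
      using infdist_le[OF assms(3), of "flow f t x"] t(1) by (simp add: nbhd_def)
    then have "flow f t x \<in> basin f (infdist x X) X"
      using \<epsilon>(2) by (rule subsetD[rotated])
    then have "infdist (flow f (- t) (flow f t x)) X < infdist x X"
      using t(2) unfolding basin_def by simp
    moreover have "flow f (- t) (flow f t x) = x"
      using x t(2) assms(1) by (intro flow_inverse) (auto simp: unstable_manifold_def)
    ultimately show False by simp
  qed
qed

theorem theorem3p1:
  fixes f :: "real^'n \<Rightarrow> real^'n"
    and G :: "(real^'n^'n) set"
    and X :: "(real^'n) set"
  assumes "smooth f"
    and "compact_matrix_group G"
    and "equivariant G f"
    and "robust_heteroclinic_cycle f G X \<or> robust_heteroclinic_network f G X"
    and "compact X"
    and "\<exists>\<xi>\<in>X. equilibrium f \<xi> \<and> \<not> unstable_manifold f \<xi> \<subseteq> X"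
  shows "\<not> asymptotically_stable f X"
proof -
  have C1: "C_k 1 f"
    using assms(1) unfolding smooth_def by (rule spec)
  obtain \<xi> where "\<xi> \<in> X" "\<not> unstable_manifold f \<xi> \<subseteq> X"
    using assms(6) by auto
  then show ?thesis
    using asymptotically_stable_imp_unstable_manifold_subset[OF C1 compact_imp_closed[OF assms(5)]]
    by metis
qed

end
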